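(* The limits $\lim_{n\to\infty}\sqrt[n]{|S_{St^3_n}(321)|}$ and $\lim_{n\to\infty}\sqrt[n]{|S_{St^3_n}(312)|}$ exist, and \[\lim_{n\to\infty}\sqrt[n]{|S_{St^3_n}(321)|}=\lim_{n\to\infty}\sqrt[n]{|S_{St^3_n}(312)|}=\psi^2=\frac{3+\sqrt5}{2},\qquad \psi=\frac{1+\sqrt5}{2}.\]
   Context: $Y(a_1,\ldots,a_n)$, with $a_1\ge\cdots\ge a_n\ge 1$, denotes the left-justified Young diagram whose $i$-th row from the top has $a_i$ cells; $(x,y)$ denotes the cell in column $x$ (from the left) and row $y$ (from the bottom). $St^3_n$ is the Young diagram of size $n$ (with $n$ rows and $n$ columns) whose $j$-th row from the bottom has $\min(n,j+2)$ cells, $1\le j\le n$ (the $n\times n$ square for $n\le3$, and $Y(n,n,n,n-1,\ldots,4,3)$ for $n\ge4$). For a Young diagram $Y$ with $n$ rows and $n$ columns, a transversal $T$ of $Y$ is a set of $n$ cells of $Y$ with exactly one in every row and every column; equivalently a permutation $\pi$ of $\{1,\ldots,n\}$ such that every cell $(x,\pi(x))$ lies in $Y$. $T$ contains the pattern $\tau\in S_k$ (one-line notation) in $Y$ if there are columns $x_1<\cdots<x_k$ such that $(\pi(x_1),\ldots,\pi(x_k))$ is order-isomorphic to $\tau$ and the cell $(x_k,\min_j\pi(x_j))$ belongs to $Y$. $S_Y(\tau)$ is the set of transversals of $Y$ that do not contain $\tau$ in $Y$. (In the paper these limits are the generalized Stanley-Wilf limits $L_{\vec Y}(\tau)=\lim_{n\to\infty}\sqrt[n]{|S_{Y^n}(\tau)|}$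 along the sequence $\vec Y=\{Y^n\}=\{St^3_n\}$.) *)

theory Defs
  imports Complex_Main
begin

text \<open>Cells are pairs (column, row), columns numbered from the left and rows from the bottom,
  both starting at 1; the list \<open>a\<close> gives the row lengths from the top row down.\<close>

definition young_diagram :: "nat list \<Rightarrow> (nat \<times> nat) set" where
  "young_diagram a =
     {(x, y). 1 \<le> y \<and> y \<le> length a \<and> 1 \<le> x \<and> x \<le> a ! (length a - y)}"

definition St3 :: "nat \<Rightarrow> (nat \<times> nat) set" where
  "St3 n = young_diagram (rev (map (\<lambda>j. min n (j + 2)) [1..<Suc n]))"

text \<open>For a diagram \<open>Y\<close>, the nonempty columns are \<open>fst ` Y\<close> and the nonempty rows
  are \<open>snd ` Y\<close>.\<close>

definition transversal :: "(nat \<times> nat) set \<Rightarrow> (nat \<times> nat) set \<Rightarrow> bool" where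
  "transversal Y T \<longleftrightarrow>
     T \<subseteq> Y \<and> (\<forall>x\<in>fst ` Y. \<exists>!y. (x, y) \<in> T) \<and> (\<forall>y\<in>snd ` Y. \<exists>!x. (x, y) \<in> T)"

definition order_isomorphic :: "nat list \<Rightarrow> nat list \<Rightarrow> bool" where
  "order_isomorphic u v \<longleftrightarrow>
     length u = length v \<and>
     (\<forall>i<length u. \<forall>j<length u. u ! i < u ! j \<longleftrightarrow> v ! i < v ! j)"

text \<open>The pattern \<open>\<tau>\<close> is given in one-line notation. The cell \<open>(last xs, Min (set ys))\<close>
  is the bottom right corner of the smallest rectangle containing the occurrence.\<close>

definition contains_pattern ::
    "(nat \<times> nat) set \<Rightarrow> (nat \<times> nat) set \<Rightarrow> nat list \<Rightarrow> bool" where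
  "contains_pattern Y T \<tau> \<longleftrightarrow>
     (\<exists>xs ys. length xs = length \<tau> \<and> sorted_wrt (<) xs \<and> order_isomorphic ys \<tau> \<and>
        (\<forall>i<length \<tau>. (xs ! i, ys ! i) \<in> T) \<and> (last xs, Min (set ys)) \<in> Y)"

definition avoiding_transversals ::
    "(nat \<times> nat) set \<Rightarrow> nat list \<Rightarrow> (nat \<times> nat) set set" where
  "avoiding_transversals Y \<tau> = {T. transversal Y T \<and> \<not> contains_pattern Y T \<tau>}"

lemma mem_St3_iff:
  "(x, y) \<in> St3 n \<longleftrightarrow> x \<in> {1..n} \<and> y \<in> {1..n} \<and> x \<le> y + 2"
  by (auto simp: St3_def young_diagram_def rev_nth simp del: upt_Suc)

lemma St3_eq:
  assumes "n \<ge> 4"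
  shows "St3 n = young_diagram ([n, n] @ rev [3..<Suc n])"
proof -
  have "rev (map (\<lambda>j. min n (j + 2)) [1..<Suc n]) = [n, n] @ rev [3..<Suc n]"
    using assms
    by (intro nth_equalityI) (auto simp: rev_nth nth_append nth_Cons' simp del: upt_Suc)
  then show ?thesis
    by (simp add: St3_def)
qed

lemma finite_avoiding_transversals_St3: "finite (avoiding_transversals (St3 n) \<tau>)"
proof -
  have "St3 n \<subseteq> {1..n} \<times> {1..n}"
    by (auto simp: mem_St3_iff)
  then have "finite (Pow (St3 n))"
    by (simp add: finite_subset)
  moreover have "avoiding_transversals (St3 n) \<tau> \<subseteq> Pow (St3 n)"
    by (auto simp: avoiding_transversals_def transversal_def)
  ultimately show ?thesis
    by (rule rev_finite_subset)
qed

end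

theory Submission imports Defs "HOL-Number_Theory.Fib" "HOL-Combinatorics.Multiset_Permutations" begin

text \<open>
  Read a transversal row by row from the top row down, recording the column of the cell in each
  row. The transversals of the staircase of size \<open>n\<close> become the lists that
  permute \<open>{1..n}\<close> and whose entry in row \<open>y\<close> (counted from the bottom) is at
  most \<open>y + 2\<close>. The largest entry \<open>n\<close> therefore lies in one of the rows
  \<open>n - 2\<close>, \<open>n - 1\<close>, \<open>n\<close>, that is, at one of the first three places
  of the list. Deleting it moves at most two entries down by one row, and these cells stay inside
  the smaller staircase. Conversely, after inserting \<open>n + 1\<close> at one of the first three places
  all cells lie in the larger staircase. The occurrences of either pattern that do not involve the
  new entry are the same before and after the insertion: the bottom cell of an occurrence has two
  entries above it, so it keeps its row, and among the rows of the occurrence this is the one that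
  decides whether the corner lies in the diagram.

  Which insertions create an occurrence depends only on the order of the first two entries
  \<open>b\<close>, \<open>a\<close> of the list. For \<open>321\<close>, the third place is forbidden if
  \<open>b < a\<close>; for \<open>312\<close>, the second place is forbidden if \<open>b < a\<close>; the other
  places are always free (\<open>sites_pat321\<close>, \<open>sites_pat312\<close>). In both cases the numbers
  \<open>A n\<close> and \<open>D n\<close> of avoiders with \<open>a < b\<close> and with \<open>b < a\<close> satisfy
  \<open>A (n + 1) = 2 * A n + D n\<close> and \<open>D (n + 1) = A n + D n\<close>, with \<open>A 2 = D 2 = 1\<close>.
  So \<open>A n = fib (2 * n - 2)\<close> and \<open>D n = fib (2 * n - 3)\<close>, and there are
  \<open>fib (2 * n - 1)\<close> avoiders of either pattern (\<open>card_avoiders\<close>). Their growth rate is the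
  square of the golden ratio.
\<close>

section \<open>Lists of columns and occurrences of patterns\<close>

text \<open>The cells of a filling with one cell in each row, given by the list of their columns from the
  top row down: the head of a list of length \<open>n\<close> is in row \<open>n\<close>.\<close>

primrec cells :: "nat list \<Rightarrow> (nat \<times> nat) set" where
  "cells [] = {}"
| "cells (x # xs) = insert (x, Suc (length xs)) (cells xs)"

lemma mem_cells_iff:
  "(x, y) \<in> cells xs \<longleftrightarrow> 1 \<le> y \<and> y \<le> length xs \<and> x = xs ! (length xs - y)"
  by (induction xs) (auto simp: nth_Cons' le_Suc_eq)

lemma cells_row_bounds: "(x, y) \<in> cells xs \<Longrightarrow> 1 \<le> y \<and> y \<le> length xs"
  by (simp add: mem_cells_iff)

lemma cells_column: "(x, y) \<in> cells xs \<Longrightarrow> x \<in> set xs"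
  by (induction xs) auto

lemma cells_subset_Cons: "cells xs \<subseteq> cells (x # xs)"
  by auto

lemma inj_on_cells: "inj_on cells {xs. length xs = n}"
proof (rule inj_onI)
  fix xs zs assume len: "xs \<in> {xs. length xs = n}" "zs \<in> {xs. length xs = n}"
    and eq: "cells xs = cells zs"
  show "xs = zs"
  proof (rule nth_equalityI)
    show "length xs = length zs" using len by simp
    fix i assume "i < length xs"
    then have "(xs ! i, length xs - i) \<in> cells xs"
      by (simp add: mem_cells_iff)
    then have "(xs ! i, length xs - i) \<in> cells zs"
      using eq by simp
    then show "xs ! i = zs ! i"
      using len \<open>i < length xs\<close> by (simp add: mem_cells_iff)
  qed
qed

text \<open>A pattern of length three is described by the condition \<open>R c b a v\<close> on three cells in
  columns \<open>c\<close>, \<open>b\<close>, \<open>a\<close> from the top row down, where \<open>v\<close> is the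
  row of the lowest one. This row is needed to say that the corner of the occurrence lies in the
  staircase.\<close>

type_synonym triple_pattern = "nat \<Rightarrow> nat \<Rightarrow> nat \<Rightarrow> nat \<Rightarrow> bool"

text \<open>The entry \<open>c\<close>, put in a row above those of \<open>xs\<close>, is the top cell of an
  occurrence.\<close>

definition pairs_with :: "triple_pattern \<Rightarrow> nat \<Rightarrow> nat list \<Rightarrow> bool" where
  "pairs_with R c xs \<longleftrightarrow> (\<exists>b w a v. (b, w) \<in> cells xs \<and> (a, v) \<in> cells xs \<and> v < w \<and> R c b a v)"

text \<open>The filling \<open>xs\<close> contains an occurrence of \<open>R\<close>.\<close>

definition occurs :: "triple_pattern \<Rightarrow> nat list \<Rightarrow> bool" where
  "occurs R xs \<longleftrightarrow> (\<exists>c u b w a v. (c, u) \<in> cells xs \<and> (b, w) \<in> cells xs \<and> (a, v) \<in> cells xs \<and>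
     v < w \<and> w < u \<and> R c b a v)"

lemma pairs_with_Cons:
  "pairs_with R c (b # xs) \<longleftrightarrow> pairs_with R c xs \<or> (\<exists>a v. (a, v) \<in> cells xs \<and> R c b a v)"
  (is "?L \<longleftrightarrow> ?R")
proof
  assume ?L
  then show ?R
    unfolding pairs_with_def using cells_row_bounds by fastforce
next
  assume ?R
  then show ?L
  proof
    assume "pairs_with R c xs"
    then show ?L unfolding pairs_with_def by auto
  next
    assume "\<exists>a v. (a, v) \<in> cells xs \<and> R c b a v"
    then obtain a v where "(a, v) \<in> cells xs" "R c b a v" "v < Suc (length xs)"
      using cells_row_bounds by fastforce
    moreover have "(b, Suc (length xs)) \<in> cells (b # xs)" by simp
    ultimately show ?L unfolding pairs_with_def by (meson cells_subset_Cons subsetD)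
  qed
qed

lemma pairs_with_Nil: "\<not> pairs_with R c []"
  by (simp add: pairs_with_def)

lemma occurs_Nil: "\<not> occurs R []"
  by (simp add: occurs_def)

lemma occurs_Cons: "occurs R (c # xs) \<longleftrightarrow> occurs R xs \<or> pairs_with R c xs" (is "?L \<longleftrightarrow> ?R")
proof
  assume ?L
  then show ?R
    unfolding occurs_def pairs_with_def using cells_row_bounds by fastforce
next
  assume ?R
  then show ?L
  proof
    assume "occurs R xs"
    then show ?L unfolding occurs_def by (meson cells_subset_Cons subsetD)
  next
    assume "pairs_with R c xs"
    then obtain b w a v where "(b, w) \<in> cells xs" "(a, v) \<in> cells xs" "v < w" "R c b a v"
      "w < Suc (length xs)"
      unfolding pairs_with_def using cells_row_bounds by fastforce
    moreover have "(c, Suc (length xs)) \<in> cells (c # xs)" by simp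
    ultimately show ?L unfolding occurs_def by (meson cells_subset_Cons subsetD)
  qed
qed

text \<open>For \<open>321\<close>, read from the top row down the columns increase. The corner of the occurrence is
  its lowest cell, so it always lies in the diagram.\<close>

definition pat321 :: triple_pattern where
  "pat321 c b a v \<longleftrightarrow> c < b \<and> b < a"

text \<open>For \<open>312\<close>, the middle cell is the rightmost one, and the corner \<open>(b, v)\<close> has to lie in
  the staircase.\<close>

definition pat312 :: triple_pattern where
  "pat312 c b a v \<longleftrightarrow> c < a \<and> a < b \<and> b \<le> v + 2"

text \<open>The lists that represent the transversals of the staircase of size \<open>n\<close> without an
  occurrence of \<open>R\<close>.\<close>

definition avoiders :: "triple_pattern \<Rightarrow> nat \<Rightarrow> nat list set" where
  "avoiders R n = {xs \<in> permutations_of_set {1..n}.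
     (\<forall>(x, y) \<in> cells xs. x \<le> y + 2) \<and> \<not> occurs R xs}"

lemma avoiders_length: "xs \<in> avoiders R n \<Longrightarrow> length xs = n"
  using length_finite_permutations_of_set[of xs "{1..n}"] by (simp add: avoiders_def)

lemma finite_avoiders: "finite (avoiders R n)"
  by (rule finite_subset[OF _ finite_permutations_of_set]) (auto simp: avoiders_def)

section \<open>Transversals of the staircase as lists\<close>

lemma order_isomorphic_3:
  "order_isomorphic [y1, y2, y3] [p, q, r] \<longleftrightarrow>
     (y1 < y2 \<longleftrightarrow> p < q) \<and> (y2 < y1 \<longleftrightarrow> q < p) \<and> (y1 < y3 \<longleftrightarrow> p < r) \<and>
     (y3 < y1 \<longleftrightarrow> r < p) \<and> (y2 < y3 \<longleftrightarrow> q < r) \<and> (y3 < y2 \<longleftrightarrow> r < q)"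
  by (auto simp: order_isomorphic_def All_less_Suc nth_Cons')

lemma contains_pattern_3:
  "contains_pattern Y T [p, q, r] \<longleftrightarrow>
     (\<exists>x1 x2 x3 y1 y2 y3. x1 < x2 \<and> x2 < x3 \<and> order_isomorphic [y1, y2, y3] [p, q, r] \<and>
       (x1, y1) \<in> T \<and> (x2, y2) \<in> T \<and> (x3, y3) \<in> T \<and> (x3, min y1 (min y2 y3)) \<in> Y)"
  (is "?L \<longleftrightarrow> ?R")
proof
  assume ?L
  then obtain xs ys where *: "length xs = 3" "sorted_wrt (<) xs" "order_isomorphic ys [p, q, r]"
    "\<forall>i<3. (xs ! i, ys ! i) \<in> T" "(last xs, Min (set ys)) \<in> Y"
    by (auto simp: contains_pattern_def eval_nat_numeral)
  obtain x1 x2 x3 where xs: "xs = [x1, x2, x3]"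
    using *(1) by (auto simp: eval_nat_numeral length_Suc_conv)
  obtain y1 y2 y3 where ys: "ys = [y1, y2, y3]"
    using *(3) by (auto simp: order_isomorphic_def length_Suc_conv)
  show ?R
    using * unfolding xs ys by (auto simp: eval_nat_numeral All_less_Suc) blast
next
  assume ?R
  then obtain x1 x2 x3 y1 y2 y3 where "x1 < x2" "x2 < x3" "order_isomorphic [y1, y2, y3] [p, q, r]"
       "(x1, y1) \<in> T" "(x2, y2) \<in> T" "(x3, y3) \<in> T" "(x3, min y1 (min y2 y3)) \<in> Y" by blast
  then show ?L
    unfolding contains_pattern_def
    by (intro exI[of _ "[x1, x2, x3]"] exI[of _ "[y1, y2, y3]"]) (auto simp: All_less_Suc)
qed

lemma fst_St3: "fst ` St3 n = {1..n}" and snd_St3: "snd ` St3 n = {1..n}"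
proof -
  have "(i, i) \<in> St3 n" if "i \<in> {1..n}" for i
    using that by (simp add: mem_St3_iff)
  then have "{1..n} \<subseteq> fst ` St3 n" "{1..n} \<subseteq> snd ` St3 n"
    by force+
  then show "fst ` St3 n = {1..n}" and "snd ` St3 n = {1..n}"
    using mem_St3_iff by auto
qed

lemma transversal_cells_iff:
  assumes "length xs = n"
  shows "transversal (St3 n) (cells xs) \<longleftrightarrow>
    xs \<in> permutations_of_set {1..n} \<and> (\<forall>(x, y) \<in> cells xs. x \<le> y + 2)" (is "?L \<longleftrightarrow> ?R")
proof
  assume L: ?L
  then have sub: "cells xs \<subseteq> St3 n" and ex1: "\<forall>x\<in>{1..n}. \<exists>!y. (x, y) \<in> cells xs"
    by (auto simp: transversal_def fst_St3)
  have "{1..n} \<subseteq> set xs"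
  proof
    fix x assume "x \<in> {1..n}"
    then obtain y where "(x, y) \<in> cells xs" using ex1 by blast
    then show "x \<in> set xs" by (rule cells_column)
  qed
  moreover have "x \<in> {1..n}" if x: "x \<in> set xs" for x
  proof -
    obtain i where "i < length xs" "x = xs ! i" using x unfolding in_set_conv_nth by blast
    then have "(x, n - i) \<in> cells xs" using assms by (simp add: mem_cells_iff)
    then show ?thesis using sub by (auto simp: mem_St3_iff)
  qed
  ultimately have set: "set xs = {1..n}" by blast
  moreover have "distinct xs" using set assms by (simp add: card_distinct)
  ultimately show ?R using sub by (auto simp: mem_St3_iff intro: permutations_of_setI)
next
  assume ?R
  then have R: "distinct xs" "set xs = {1..n}" "\<forall>(x, y) \<in> cells xs. x \<le> y + 2"
    by (auto dest: permutations_of_setD)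
  have sub: "cells xs \<subseteq> St3 n"
  proof
    fix z assume "z \<in> cells xs"
    then show "z \<in> St3 n"
      using R assms cells_column[of "fst z" "snd z" xs] cells_row_bounds[of "fst z" "snd z" xs]
      by (cases z) (auto simp: mem_St3_iff)
  qed
  have rows: "\<exists>!x. (x, y) \<in> cells xs" if "y \<in> {1..n}" for y
    using that assms by (auto simp: mem_cells_iff)
  have cols: "\<exists>!y. (x, y) \<in> cells xs" if "x \<in> {1..n}" for x
  proof -
    have "x \<in> set xs" using that R by simp
    then obtain i where i: "i < n" "x = xs ! i" using assms unfolding in_set_conv_nth by blast
    show ?thesis
    proof (rule ex1I)
      show "(x, n - i) \<in> cells xs" using i assms by (simp add: mem_cells_iff)
      fix y assume "(x, y) \<in> cells xs"
      then have "1 \<le> y" "y \<le> n" "xs ! i = xs ! (n - y)"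
        using i assms by (auto simp: mem_cells_iff)
      moreover from this have "i = n - y"
        using R i assms by (subst (asm) nth_eq_iff_index_eq) auto
      ultimately show "y = n - i" by linarith
    qed
  qed
  show ?L using sub rows cols by (simp add: transversal_def fst_St3 snd_St3)
qed

lemma transversal_imp_cells:
  assumes "transversal (St3 n) T"
  shows "\<exists>xs. length xs = n \<and> T = cells xs"
proof -
  define f where "f = (\<lambda>y. THE x. (x, y) \<in> T)"
  define xs where "xs = map (\<lambda>i. f (n - i)) [0..<n]"
  have ex1: "\<exists>!x. (x, y) \<in> T" if "y \<in> {1..n}" for y
    using assms that by (simp add: transversal_def snd_St3)
  have T: "(x, y) \<in> T \<longleftrightarrow> y \<in> {1..n} \<and> x = f y" for x y
  proof (cases "y \<in> {1..n}")
    case True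
    then show ?thesis using ex1[OF True] unfolding f_def
      by (metis (no_types, lifting) theI')
  next
    case False
    then show ?thesis using assms by (auto simp: transversal_def mem_St3_iff)
  qed
  have "T = cells xs"
    by (auto simp: T mem_cells_iff xs_def)
  then show ?thesis by (intro exI[of _ xs]) (simp add: xs_def)
qed

text \<open>The map \<open>cells\<close> is a bijection from the avoiding lists onto the avoiding
  transversals.\<close>

lemma card_avoiding_transversals:
  assumes "\<And>xs. length xs = n \<Longrightarrow> transversal (St3 n) (cells xs) \<Longrightarrow>
             contains_pattern (St3 n) (cells xs) \<tau> \<longleftrightarrow> occurs R xs"
  shows "card (avoiding_transversals (St3 n) \<tau>) = card (avoiders R n)"
proof -
  have "avoiding_transversals (St3 n) \<tau> = cells ` avoiders R n"
  proof (intro equalityI subsetI)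
    fix T assume "T \<in> avoiding_transversals (St3 n) \<tau>"
    moreover from this obtain xs where "length xs = n" "T = cells xs"
      using transversal_imp_cells by (auto simp: avoiding_transversals_def)
    ultimately show "T \<in> cells ` avoiders R n"
      using assms[of xs] transversal_cells_iff[of xs n]
      by (auto simp: avoiding_transversals_def avoiders_def)
  next
    fix T assume "T \<in> cells ` avoiders R n"
    then obtain xs where xs: "xs \<in> avoiders R n" "T = cells xs" by blast
    then show "T \<in> avoiding_transversals (St3 n) \<tau>"
      using assms[of xs] transversal_cells_iff[of xs n] avoiders_length[OF xs(1)]
      by (auto simp: avoiding_transversals_def avoiders_def)
  qed
  moreover have "inj_on cells (avoiders R n)"
    using inj_on_cells[of n] by (rule inj_on_subset) (auto dest: avoiders_length)
  ultimately show ?thesis by (simp add: card_image)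
qed

lemma order_isomorphic_321: "order_isomorphic [y1, y2, y3] [3, 2, 1] \<longleftrightarrow> y3 < y2 \<and> y2 < y1"
  by (auto simp: order_isomorphic_3)

lemma order_isomorphic_312: "order_isomorphic [y1, y2, y3] [3, 1, 2] \<longleftrightarrow> y2 < y3 \<and> y3 < y1"
  by (auto simp: order_isomorphic_3)

lemma card_avoiding_321:
  "card (avoiding_transversals (St3 n) [3, 2, 1]) = card (avoiders pat321 n)"
proof (rule card_avoiding_transversals)
  fix xs assume "transversal (St3 n) (cells xs)"
  then have sub: "cells xs \<subseteq> St3 n" by (simp add: transversal_def)
  show "contains_pattern (St3 n) (cells xs) [3, 2, 1] \<longleftrightarrow> occurs pat321 xs" (is "?L \<longleftrightarrow> ?R")
  proof
    assume ?L
    then show ?R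
      unfolding contains_pattern_3 order_isomorphic_321 occurs_def pat321_def by blast
  next
    assume ?R
    then obtain c u b w a v where *: "(c, u) \<in> cells xs" "(b, w) \<in> cells xs" "(a, v) \<in> cells xs"
      "v < w" "w < u" "c < b" "b < a"
      unfolding occurs_def pat321_def by blast
    moreover have "(a, min u (min w v)) \<in> St3 n" using sub * by (simp add: min_def subset_iff)
    ultimately show ?L
      unfolding contains_pattern_3 order_isomorphic_321 by blast
  qed
qed

lemma card_avoiding_312:
  "card (avoiding_transversals (St3 n) [3, 1, 2]) = card (avoiders pat312 n)"
proof (rule card_avoiding_transversals)
  fix xs assume "transversal (St3 n) (cells xs)"
  then have sub: "cells xs \<subseteq> St3 n" by (simp add: transversal_def)
  show "contains_pattern (St3 n) (cells xs) [3, 1, 2] \<longleftrightarrow> occurs pat312 xs" (is "?L \<longleftrightarrow> ?R")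
  proof
    assume ?L
    then obtain x1 x2 x3 y1 y2 y3 where *: "x1 < x2" "x2 < x3" "y2 < y3" "y3 < y1"
       "(x1, y1) \<in> cells xs" "(x2, y2) \<in> cells xs" "(x3, y3) \<in> cells xs"
       "(x3, min y1 (min y2 y3)) \<in> St3 n"
      unfolding contains_pattern_3 order_isomorphic_312 by blast
    have "x3 \<le> y2 + 2" using *(3,4,8) by (simp add: min_def mem_St3_iff)
    with * show ?R unfolding occurs_def pat312_def by blast
  next
    assume ?R
    then obtain c u b w a v where *: "(c, u) \<in> cells xs" "(b, w) \<in> cells xs" "(a, v) \<in> cells xs"
      "v < w" "w < u" "c < a" "a < b" "b \<le> v + 2"
      unfolding occurs_def pat312_def by blast
    have "(b, w) \<in> St3 n" "(a, v) \<in> St3 n"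
      using * sub by auto
    then have "(b, min u (min v w)) \<in> St3 n" using * by (simp add: min_def mem_St3_iff)
    with * show ?L unfolding contains_pattern_3 order_isomorphic_312 by blast
  qed
qed

section \<open>Inserting the last column\<close>

text \<open>Ascents and descents refer to the order of the rows from the bottom up, so at an ascent the
  first entry of the list exceeds the second one.\<close>

definition ascending :: "triple_pattern \<Rightarrow> nat \<Rightarrow> nat list set" where
  "ascending R n = {xs \<in> avoiders R n. xs ! 1 < xs ! 0}"

definition descending :: "triple_pattern \<Rightarrow> nat \<Rightarrow> nat list set" where
  "descending R n = {xs \<in> avoiders R n. xs ! 0 < xs ! 1}"

definition insert_at :: "nat \<Rightarrow> nat \<Rightarrow> nat list \<Rightarrow> nat list" where
  "insert_at k m xs = take k xs @ m # drop k xs"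

lemma inj_on_insert_at: "inj_on (insert_at k m) {xs. k \<le> length xs}"
proof (rule inj_on_inverseI)
  fix xs :: "nat list" assume "xs \<in> {xs. k \<le> length xs}"
  then show "take k (insert_at k m xs) @ drop (Suc k) (insert_at k m xs) = xs"
    by (simp add: insert_at_def)
qed

lemma card_insert_at:
  assumes "B \<subseteq> avoiders R n" "k \<le> n"
  shows "card (insert_at k m ` B) = card B"
proof (rule card_image)
  have "B \<subseteq> {xs. k \<le> length xs}" using assms avoiders_length by fastforce
  then show "inj_on (insert_at k m) B" by (rule inj_on_subset[OF inj_on_insert_at])
qed

lemma avoiders_Cons2:
  assumes "xs \<in> avoiders R n" "2 \<le> n"
  shows "\<exists>b a zs. xs = b # a # zs \<and> a \<noteq> b \<and> Suc (Suc (length zs)) = n"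
proof -
  have "length xs = n" using assms avoiders_length by blast
  then obtain b a zs where "xs = b # a # zs"
    using assms(2) by (cases xs; cases "tl xs") auto
  then show ?thesis
    using assms \<open>length xs = n\<close> by (auto simp: avoiders_def permutations_of_set_def)
qed

lemma avoiders_split:
  assumes "2 \<le> n"
  shows "avoiders R n = ascending R n \<union> descending R n"
  using avoiders_Cons2[OF _ assms] by (fastforce simp: ascending_def descending_def)

lemma card_avoiders_split:
  assumes "2 \<le> n"
  shows "card (avoiders R n) = card (ascending R n) + card (descending R n)"
  unfolding avoiders_split[OF assms]
  by (rule card_Un_disjoint) (auto simp: ascending_def descending_def finite_avoiders)

lemma set_insert_atLeastAtMost_Suc_iff:
  "Suc n \<notin> A \<and> insert (Suc n) A = {1..Suc n} \<longleftrightarrow> A = {1..n}"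
proof
  assume "Suc n \<notin> A \<and> insert (Suc n) A = {1..Suc n}"
  then have "A = {1..Suc n} - {Suc n}" by blast
  then show "A = {1..n}" by auto
qed auto

lemma permutation_insert_iff:
  "us @ Suc n # vs \<in> permutations_of_set {1..Suc n} \<longleftrightarrow> us @ vs \<in> permutations_of_set {1..n}"
  using set_insert_atLeastAtMost_Suc_iff[of n "set us \<union> set vs"]
  by (auto simp: permutations_of_set_def)

text \<open>In both patterns the top cell is to the left of the bottom cell, so the largest entry of a list
  is never the top cell of an occurrence.\<close>

definition first_less_last :: "triple_pattern \<Rightarrow> bool" where
  "first_less_last R \<longleftrightarrow> (\<forall>c b a v. R c b a v \<longrightarrow> c < a)"

lemma not_pairs_with_top:
  assumes "first_less_last R" "set xs \<subseteq> {..n}"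
  shows "\<not> pairs_with R (Suc n) xs"
  using assms cells_column unfolding pairs_with_def first_less_last_def by fastforce

text \<open>The next three lemmas reduce the avoidance after an insertion to the occurrences that involve
  the new entry. The third one includes the condition that the new entry is not the bottom cell of an
  occurrence; at the second place it has only one entry above it.\<close>

lemma insert_first_mem_avoiders_iff:
  assumes "first_less_last R"
  shows "Suc n # xs \<in> avoiders R (Suc n) \<longleftrightarrow> xs \<in> avoiders R n"
proof (cases "xs \<in> permutations_of_set {1..n}")
  case True
  then have len: "length (xs) = n" and le: "set (xs) \<subseteq> {..n}"
    using length_finite_permutations_of_set[OF True] permutations_of_setD(1)[OF True] by auto
  have "\<not> pairs_with R (Suc n) xs"
    using le by (intro not_pairs_with_top[OF assms]) simp
  then have "occurs R (Suc n # xs) \<longleftrightarrow> occurs R xs"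
    by (auto simp: occurs_Cons pairs_with_Cons)
  moreover have "(\<forall>(x, y) \<in> cells (Suc n # xs). x \<le> y + 2) \<longleftrightarrow>
      (\<forall>(x, y) \<in> cells (xs). x \<le> y + 2)"
    using len le by auto
  ultimately show ?thesis
    using True permutation_insert_iff[of "[]" n xs] by (auto simp: avoiders_def)
next
  case False
  then show ?thesis
    using permutation_insert_iff[of "[]" n xs] by (simp add: avoiders_def)
qed

lemma insert_second_mem_avoiders_iff:
  assumes "first_less_last R"
  shows "b # Suc n # xs \<in> avoiders R (Suc n) \<longleftrightarrow> 
    b # xs \<in> avoiders R n \<and> \<not> (\<exists>a v. (a, v) \<in> cells xs \<and> R b (Suc n) a v)"
proof (cases "b # xs \<in> permutations_of_set {1..n}")
  case True
  then have len: "length (b # xs) = n" and le: "set (b # xs) \<subseteq> {..n}"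
    using length_finite_permutations_of_set[OF True] permutations_of_setD(1)[OF True] by auto
  have "\<not> pairs_with R (Suc n) xs"
    using le by (intro not_pairs_with_top[OF assms]) simp
  then have "occurs R (b # Suc n # xs) \<longleftrightarrow> 
      occurs R (b # xs) \<or> (\<exists>a v. (a, v) \<in> cells xs \<and> R b (Suc n) a v)"
    by (auto simp: occurs_Cons pairs_with_Cons)
  moreover have "(\<forall>(x, y) \<in> cells (b # Suc n # xs). x \<le> y + 2) \<longleftrightarrow>
      (\<forall>(x, y) \<in> cells (b # xs). x \<le> y + 2)"
    using len le by auto
  ultimately show ?thesis
    using True permutation_insert_iff[of "[b]" n xs] by (auto simp: avoiders_def)
next
  case False
  then show ?thesis
    using permutation_insert_iff[of "[b]" n xs] by (simp add: avoiders_def)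
qed

lemma insert_third_mem_avoiders_iff:
  assumes "first_less_last R"
  shows "b # a # Suc n # xs \<in> avoiders R (Suc n) \<longleftrightarrow> 
    b # a # xs \<in> avoiders R n \<and> \<not> R b a (Suc n) (Suc (length xs)) \<and>
    \<not> (\<exists>a' v. (a', v) \<in> cells xs \<and> (R a (Suc n) a' v \<or> R b (Suc n) a' v))"
proof (cases "b # a # xs \<in> permutations_of_set {1..n}")
  case True
  then have len: "length (b # a # xs) = n" and le: "set (b # a # xs) \<subseteq> {..n}"
    using length_finite_permutations_of_set[OF True] permutations_of_setD(1)[OF True] by auto
  have "\<not> pairs_with R (Suc n) xs"
    using le by (intro not_pairs_with_top[OF assms]) simp
  then have "occurs R (b # a # Suc n # xs) \<longleftrightarrow> 
      occurs R (b # a # xs) \<or> R b a (Suc n) (Suc (length xs)) \<or>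
      (\<exists>a' v. (a', v) \<in> cells xs \<and> (R a (Suc n) a' v \<or> R b (Suc n) a' v))"
    by (auto simp: occurs_Cons pairs_with_Cons)
  moreover have "(\<forall>(x, y) \<in> cells (b # a # Suc n # xs). x \<le> y + 2) \<longleftrightarrow>
      (\<forall>(x, y) \<in> cells (b # a # xs). x \<le> y + 2)"
    using len le by auto
  ultimately show ?thesis
    using True permutation_insert_iff[of "[b, a]" n xs] by (auto simp: avoiders_def)
next
  case False
  then show ?thesis
    using permutation_insert_iff[of "[b, a]" n xs] by (simp add: avoiders_def)
qed

lemma top_in_last_three_rows:
  assumes "xs \<in> avoiders R (Suc n)" "2 \<le> n"
  obtains b a zs where "xs = Suc n # b # a # zs" | b a zs where "xs = b # Suc n # a # zs"
    | b a zs where "xs = b # a # Suc n # zs"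
proof -
  have len: "length xs = Suc n" using assms(1) by (rule avoiders_length)
  then obtain x y z zs where xs: "xs = x # y # z # zs"
    using assms(2) by (cases xs; cases "tl xs"; cases "tl (tl xs)") auto
  have "Suc n \<in> set xs" using assms(1) by (auto simp: avoiders_def permutations_of_set_def)
  then obtain i where i: "i < Suc n" "xs ! i = Suc n"
    using len unfolding in_set_conv_nth by auto
  then have "(Suc n, Suc n - i) \<in> cells xs"
    using len by (simp add: mem_cells_iff)
  then have "Suc n \<le> Suc n - i + 2"
    using assms(1) by (auto simp: avoiders_def)
  \<comment> \<open>Place \<open>i\<close> of the list is row \<open>n + 1 - i\<close>, and \<open>n + 1\<close> fits only in rows from \<open>n - 1\<close> on.\<close>
  then have "i = 0 \<or> i = 1 \<or> i = 2" using i(1) by linarith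
  then have "x = Suc n \<or> y = Suc n \<or> z = Suc n" using i(2) by (auto simp: xs)
  then show thesis using that xs by blast
qed

text \<open>The avoiders into which the new largest entry can be inserted at place \<open>k\<close> (counted
  from 0).\<close>

definition sites :: "triple_pattern \<Rightarrow> nat \<Rightarrow> nat \<Rightarrow> nat list set" where
  "sites R k n = {xs \<in> avoiders R n. insert_at k (Suc n) xs \<in> avoiders R (Suc n)}"

lemma avoiders_entry_le: "xs \<in> avoiders R n \<Longrightarrow> x \<in> set xs \<Longrightarrow> x \<le> n"
  by (auto simp: avoiders_def permutations_of_set_def)

lemma avoiders_Suc:
  assumes "first_less_last R" "2 \<le> n"
  shows "avoiders R (Suc n) = insert_at 0 (Suc n) ` avoiders R n \<union>
    insert_at 1 (Suc n) ` sites R 1 n \<union> insert_at 2 (Suc n) ` sites R 2 n" (is "_ = ?U")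
proof (intro equalityI subsetI)
  fix xs assume xs: "xs \<in> avoiders R (Suc n)"
  from xs assms(2) show "xs \<in> ?U"
  proof (cases rule: top_in_last_three_rows)
    case (1 b a zs)
    then have "b # a # zs \<in> avoiders R n" "xs = insert_at 0 (Suc n) (b # a # zs)"
      using xs insert_first_mem_avoiders_iff[OF assms(1)] by (auto simp: insert_at_def)
    then show ?thesis by blast
  next
    case (2 b a zs)
    then have "xs = insert_at 1 (Suc n) (b # a # zs)"
      by (simp add: insert_at_def)
    moreover have "b # a # zs \<in> avoiders R n"
      using xs 2 insert_second_mem_avoiders_iff[OF assms(1)] by blast
    ultimately show ?thesis using xs by (auto simp: sites_def)
  next
    case (3 b a zs)
    then have "xs = insert_at 2 (Suc n) (b # a # zs)"
      by (simp add: insert_at_def)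
    moreover have "b # a # zs \<in> avoiders R n"
      using xs 3 insert_third_mem_avoiders_iff[OF assms(1)] by blast
    ultimately show ?thesis using xs by (auto simp: sites_def)
  qed
next
  fix xs assume "xs \<in> ?U"
  then show "xs \<in> avoiders R (Suc n)"
    using insert_first_mem_avoiders_iff[OF assms(1)] by (auto simp: sites_def insert_at_def)
qed

text \<open>Insertion at the first place yields an ascent, at the second place a descent, and at the third
  place it keeps the first two entries.\<close>

lemma insert_at_nth_0_1:
  assumes "xs \<in> avoiders R n" "2 \<le> n"
  shows "insert_at 0 (Suc n) xs ! 1 < insert_at 0 (Suc n) xs ! 0"
    and "insert_at 1 (Suc n) xs ! 0 < insert_at 1 (Suc n) xs ! 1"
    and "insert_at 2 (Suc n) xs ! 0 = xs ! 0" "insert_at 2 (Suc n) xs ! 1 = xs ! 1"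
proof -
  obtain b a zs where xs: "xs = b # a # zs"
    using avoiders_Cons2[OF assms] by blast
  then have "b \<le> n" using avoiders_entry_le[OF assms(1)] by simp
  then show "insert_at 0 (Suc n) xs ! 1 < insert_at 0 (Suc n) xs ! 0"
    and "insert_at 1 (Suc n) xs ! 0 < insert_at 1 (Suc n) xs ! 1"
    and "insert_at 2 (Suc n) xs ! 0 = xs ! 0" "insert_at 2 (Suc n) xs ! 1 = xs ! 1"
    by (simp_all add: xs insert_at_def)
qed

lemma ascending_Suc:
  assumes "first_less_last R" "2 \<le> n"
  shows "ascending R (Suc n) = insert_at 0 (Suc n) ` avoiders R n \<union>
    insert_at 2 (Suc n) ` (sites R 2 n \<inter> ascending R n)"
  unfolding ascending_def avoiders_Suc[OF assms]
  using insert_at_nth_0_1[OF _ assms(2)] by (force simp: sites_def)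

lemma descending_Suc:
  assumes "first_less_last R" "2 \<le> n"
  shows "descending R (Suc n) = insert_at 1 (Suc n) ` sites R 1 n \<union>
    insert_at 2 (Suc n) ` (sites R 2 n \<inter> descending R n)"
  unfolding descending_def avoiders_Suc[OF assms]
  using insert_at_nth_0_1[OF _ assms(2)] by (force simp: sites_def)

lemma insert_at_nth:
  "k \<le> length xs \<Longrightarrow> insert_at k m xs ! k = m"
  by (simp add: insert_at_def nth_append)

lemma insert_at_disjoint:
  assumes "B \<subseteq> avoiders R n" "C \<subseteq> avoiders R n" "k < l" "l \<le> n"
  shows "insert_at k (Suc n) ` B \<inter> insert_at l (Suc n) ` C = {}"
proof -
  have "insert_at k (Suc n) xs \<noteq> insert_at l (Suc n) zs" if "xs \<in> B" "zs \<in> C" for xs zs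
  proof -
    have zs: "zs \<in> avoiders R n" "length zs = n" "length xs = n"
      using that assms avoiders_length by blast+
    then have "insert_at l (Suc n) zs ! k = zs ! k"
      using assms by (simp add: insert_at_def nth_append)
    moreover have "zs ! k \<le> n"
      using zs assms by (intro avoiders_entry_le[OF zs(1)]) simp
    moreover have "insert_at k (Suc n) xs ! k = Suc n"
      using zs assms by (simp add: insert_at_nth)
    ultimately have "insert_at k (Suc n) xs ! k \<noteq> insert_at l (Suc n) zs ! k" by linarith
    then show ?thesis by force
  qed
  then show ?thesis by blast
qed

lemma card_insert_at_Un:
  assumes "B \<subseteq> avoiders R n" "C \<subseteq> avoiders R n" "k < l" "l \<le> n"
  shows "card (insert_at k (Suc n) ` B \<union> insert_at l (Suc n) ` C) = card B + card C"
proof -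
  have "finite B" "finite C" using assms finite_avoiders finite_subset by blast+
  then have "card (insert_at k (Suc n) ` B \<union> insert_at l (Suc n) ` C) =
      card (insert_at k (Suc n) ` B) + card (insert_at l (Suc n) ` C)"
    by (intro card_Un_disjoint insert_at_disjoint[OF assms]) auto
  then show ?thesis
    using card_insert_at[OF assms(1), of k] card_insert_at[OF assms(2), of l] assms by simp
qed

lemma card_ascending_Suc:
  assumes "first_less_last R" "2 \<le> n"
  shows "card (ascending R (Suc n)) = card (avoiders R n) + card (sites R 2 n \<inter> ascending R n)"
  unfolding ascending_Suc[OF assms]
  by (rule card_insert_at_Un) (use assms in \<open>auto simp: sites_def\<close>)

lemma card_descending_Suc:
  assumes "first_less_last R" "2 \<le> n"
  shows "card (descending R (Suc n)) = card (sites R 1 n) + card (sites R 2 n \<inter> descending R n)"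
  unfolding descending_Suc[OF assms]
  by (rule card_insert_at_Un) (use assms in \<open>auto simp: sites_def\<close>)

section \<open>The number of avoiders\<close>

lemma first_less_last_pat321: "first_less_last pat321"
  and first_less_last_pat312: "first_less_last pat312"
  by (auto simp: first_less_last_def pat321_def pat312_def)

text \<open>The largest entry can only be the bottom cell of an occurrence of \<open>321\<close>; the other two
  cells are then the first two entries.\<close>

lemma sites_pat321:
  assumes "2 \<le> n"
  shows "sites pat321 1 n = avoiders pat321 n" "sites pat321 2 n = ascending pat321 n"
proof -
  have *: "(insert_at 1 (Suc n) xs \<in> avoiders pat321 (Suc n)) \<and>
    (insert_at 2 (Suc n) xs \<in> avoiders pat321 (Suc n) \<longleftrightarrow> xs ! 1 < xs ! 0)"
    if xs: "xs \<in> avoiders pat321 n" for xs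
  proof -
    obtain b a zs where eq: "xs = b # a # zs" "a \<noteq> b"
      using avoiders_Cons2[OF xs assms] by blast
    have le: "x \<le> n" if "x \<in> set xs" for x
      using avoiders_entry_le[OF xs that] .
    have none: "\<not> pat321 c (Suc n) x v" if "(x, v) \<in> cells (a # zs)" for c x v
      using le[of x] cells_column[OF that] unfolding eq(1) by (auto simp: pat321_def)
    then have "insert_at 1 (Suc n) xs \<in> avoiders pat321 (Suc n)"
      using xs insert_second_mem_avoiders_iff[OF first_less_last_pat321, of b n "a # zs"]
      unfolding eq(1) by (simp add: insert_at_def) blast
    moreover have "pat321 b a (Suc n) (Suc (length zs)) \<longleftrightarrow> b < a"
      using le[of a] eq(1) by (auto simp: pat321_def)
    then have "insert_at 2 (Suc n) xs \<in> avoiders pat321 (Suc n) \<longleftrightarrow> xs ! 1 < xs ! 0"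
      using xs none insert_third_mem_avoiders_iff[OF first_less_last_pat321, of b a n zs] eq(2)
      unfolding eq(1) by (auto simp: insert_at_def)
    ultimately show ?thesis by blast
  qed
  then show "sites pat321 1 n = avoiders pat321 n" "sites pat321 2 n = ascending pat321 n"
    by (auto simp: sites_def ascending_def)
qed

text \<open>The largest entry \<open>n + 1\<close> can only be the middle cell of an occurrence of \<open>312\<close>. Its
  corner lies in the diagram only if the bottom cell is in row \<open>n - 1\<close> or above, and this
  leaves only the case where the three cells are the first three entries.\<close>

lemma sites_pat312:
  assumes "2 \<le> n"
  shows "sites pat312 1 n = ascending pat312 n" "sites pat312 2 n = avoiders pat312 n"
proof -
  have *: "(insert_at 2 (Suc n) xs \<in> avoiders pat312 (Suc n)) \<and>
    (insert_at 1 (Suc n) xs \<in> avoiders pat312 (Suc n) \<longleftrightarrow> xs ! 1 < xs ! 0)"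
    if xs: "xs \<in> avoiders pat312 n" for xs
  proof -
    obtain b a zs where eq: "xs = b # a # zs" "a \<noteq> b" and len: "Suc (Suc (length zs)) = n"
      using avoiders_Cons2[OF xs assms] by blast
    have le: "x \<le> n" if "x \<in> set xs" for x
      using avoiders_entry_le[OF xs that] .
    have low: "\<not> pat312 c (Suc n) x v" if "(x, v) \<in> cells zs" for c x v
      using cells_row_bounds[OF that] len by (simp add: pat312_def)
    moreover have "\<not> pat312 b a (Suc n) v" for v
      using le[of a] eq by (auto simp: pat312_def)
    ultimately have "insert_at 2 (Suc n) xs \<in> avoiders pat312 (Suc n)"
      using xs insert_third_mem_avoiders_iff[OF first_less_last_pat312, of b a n zs]
      unfolding eq by (auto simp: insert_at_def)
    moreover have "pat312 b (Suc n) a (Suc (length zs)) \<longleftrightarrow> b < a"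
      using le[of a] len eq(1) by (auto simp: pat312_def)
    then have "(\<exists>x v. (x, v) \<in> cells (a # zs) \<and> pat312 b (Suc n) x v) \<longleftrightarrow> b < a"
      using low by auto
    then have "insert_at 1 (Suc n) xs \<in> avoiders pat312 (Suc n) \<longleftrightarrow> xs ! 1 < xs ! 0"
      using xs insert_second_mem_avoiders_iff[OF first_less_last_pat312, of b n "a # zs"] eq(2)
      unfolding eq(1) by (auto simp: insert_at_def)
    ultimately show ?thesis by blast
  qed
  then show "sites pat312 1 n = ascending pat312 n" "sites pat312 2 n = avoiders pat312 n"
    by (auto simp: sites_def ascending_def)
qed

lemma ascending_descending_Int: "ascending R n \<inter> descending R n = {}"
    "avoiders R n \<inter> ascending R n = ascending R n"
    "avoiders R n \<inter> descending R n = descending R n"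
  by (auto simp: ascending_def descending_def)

lemma card_ascending_descending_Suc:
  assumes "R = pat321 \<or> R = pat312" "2 \<le> n"
  shows "card (ascending R (Suc n)) = card (avoiders R n) + card (ascending R n)"
    and "card (descending R (Suc n)) = card (avoiders R n)"
  using assms(1)
    card_ascending_Suc[OF first_less_last_pat321 assms(2)]
    card_ascending_Suc[OF first_less_last_pat312 assms(2)]
    card_descending_Suc[OF first_less_last_pat321 assms(2)]
    card_descending_Suc[OF first_less_last_pat312 assms(2)]
  by (auto simp: sites_pat321[OF assms(2)] sites_pat312[OF assms(2)] ascending_descending_Int
        card_avoiders_split[OF assms(2)] simp del: One_nat_def)

lemma avoiders_2: "avoiders R 2 = {[1, 2], [2, 1]}"
proof -
  have "{1..2} = {1, 2 :: nat}" by auto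
  then have "permutations_of_set {1..2} = {[1, 2], [2, 1 :: nat]}"
    by (simp add: permutations_of_set_doubleton)
  moreover have "\<not> occurs R [b, a]" for a b
    by (simp add: occurs_Cons pairs_with_Cons occurs_Nil pairs_with_Nil)
  ultimately show ?thesis
    by (auto simp: avoiders_def)
qed

lemma card_ascending_descending:
  assumes "R = pat321 \<or> R = pat312"
  shows "card (ascending R (n + 2)) = fib (2 * n + 2) \<and> card (descending R (n + 2)) = fib (2 * n + 1)"
proof (induction n)
  case 0
  have "ascending R 2 = {[2, 1]}" "descending R 2 = {[1, 2]}"
    by (auto simp: ascending_def descending_def avoiders_2)
  then show ?case by (simp add: numeral_2_eq_2)
next
  case (Suc n)
  then show ?case
    using card_ascending_descending_Suc[OF assms, of "n + 2"] card_avoiders_split[of "n + 2" R]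
    by (simp add: eval_nat_numeral)
qed

lemma card_avoiders:
  assumes "R = pat321 \<or> R = pat312" "2 \<le> n"
  shows "card (avoiders R n) = fib (2 * n - 1)"
proof -
  obtain m where "n = m + 2" using assms(2) by (metis add.commute le_Suc_ex)
  then show ?thesis
    using card_ascending_descending[OF assms(1), of m] card_avoiders_split[OF assms(2), of R]
    by (simp add: eval_nat_numeral)
qed

section \<open>The growth rate\<close>

lemma root_tendsto_1:
  fixes X :: "nat \<Rightarrow> real"
  assumes "X \<longlonglongrightarrow> L" "0 < L"
  shows "(\<lambda>n. root n (X n)) \<longlonglongrightarrow> 1"
proof (rule tendsto_sandwich)
  have "\<forall>\<^sub>F n in sequentially. L / 2 < X n"
    using assms by (intro order_tendstoD(1)[OF assms(1)]) simp
  moreover have "\<forall>\<^sub>F n in sequentially. X n < 2 * L"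
    using assms by (intro order_tendstoD(2)[OF assms(1)]) simp
  ultimately show "\<forall>\<^sub>F n in sequentially. root n (L / 2) \<le> root n (X n)"
    "\<forall>\<^sub>F n in sequentially. root n (X n) \<le> root n (2 * L)"
    using eventually_gt_at_top[of "0 :: nat"] by (eventually_elim, simp)+
  show "(\<lambda>n. root n (L / 2)) \<longlonglongrightarrow> 1" "(\<lambda>n. root n (2 * L)) \<longlonglongrightarrow> 1"
    using assms(2) by (auto intro: LIMSEQ_root_const)
qed

lemma root_fib_tendsto:
  fixes \<psi> :: real
  defines "\<psi> \<equiv> (1 + sqrt 5) / 2"
  shows "(\<lambda>n. root n (real (fib (2 * n - 1)))) \<longlonglongrightarrow> \<psi>\<^sup>2"
proof -
  have pos: "0 < \<psi>" by (simp add: \<psi>_def add_pos_nonneg)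
  \<comment> \<open>\<open>X n\<close> converges to the positive constant \<open>1 / (\<psi> * sqrt 5)\<close>, whose \<open>n\<close>-th root tends to 1.\<close>
  define X where "X n = real (fib (2 * n - 1)) / \<psi> ^ (2 * n)" for n
  have "filterlim (\<lambda>n. 2 * n - 1 :: nat) sequentially sequentially"
    by (intro filterlim_subseq) (auto simp: strict_mono_Suc_iff)
  then have "(\<lambda>n. real (fib (2 * n - 1)) / (\<psi> ^ (2 * n - 1) / sqrt 5)) \<longlonglongrightarrow> 1"
    using fib_asymptotics[folded \<psi>_def] by (rule filterlim_compose[rotated])
  then have "(\<lambda>n. real (fib (2 * n - 1)) / (\<psi> ^ (2 * n - 1) / sqrt 5) / (\<psi> * sqrt 5))
      \<longlonglongrightarrow> 1 / (\<psi> * sqrt 5)"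
    using pos by (intro tendsto_divide tendsto_const) auto
  moreover have "\<forall>\<^sub>F n in sequentially.
      real (fib (2 * n - 1)) / (\<psi> ^ (2 * n - 1) / sqrt 5) / (\<psi> * sqrt 5) = X n"
    using eventually_gt_at_top[of "0 :: nat"]
  proof eventually_elim
    case (elim n)
    then have "\<psi> ^ (2 * n) = \<psi> * \<psi> ^ (2 * n - 1)"
      by (metis mult_pos_pos power_eq_if zero_less_numeral less_numeral_extra(3))
    then show ?case using pos by (simp add: X_def field_simps)
  qed
  ultimately have "X \<longlonglongrightarrow> 1 / (\<psi> * sqrt 5)"
    by (rule Lim_transform_eventually)
  then have "(\<lambda>n. root n (X n)) \<longlonglongrightarrow> 1"
    by (rule root_tendsto_1) (simp add: pos)
  then have "(\<lambda>n. root n (X n) * \<psi>\<^sup>2) \<longlonglongrightarrow> 1 * \<psi>\<^sup>2"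
    by (intro tendsto_mult tendsto_const)
  moreover have "\<forall>\<^sub>F n in sequentially. root n (X n) * \<psi>\<^sup>2 = root n (real (fib (2 * n - 1)))"
    using eventually_gt_at_top[of "0 :: nat"]
  proof eventually_elim
    case (elim n)
    have "real (fib (2 * n - 1)) = X n * (\<psi>\<^sup>2) ^ n"
      using pos by (simp add: X_def power_mult)
    then show ?case using elim pos by (simp add: real_root_mult real_root_power_cancel)
  qed
  ultimately show ?thesis
    using Lim_transform_eventually by fastforce
qed

theorem corollary2:
  fixes \<psi> :: real
  defines "\<psi> \<equiv> (1 + sqrt 5) / 2"
  shows "(\<lambda>n. root n (real (card (avoiding_transversals (St3 n) [3, 2, 1])))) \<longlonglongrightarrow> \<psi>\<^sup>2
       \<and> (\<lambda>n. root n (real (card (avoiding_transversals (St3 n) [3, 1, 2])))) \<longlonglongrightarrow> \<psi>\<^sup>2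
       \<and> \<psi>\<^sup>2 = (3 + sqrt 5) / 2"
proof (intro conjI)
  have lim: "(\<lambda>n. root n (real (card (avoiders R n)))) \<longlonglongrightarrow> \<psi>\<^sup>2" if "R = pat321 \<or> R = pat312" for R
  proof (rule Lim_transform_eventually)
    show "(\<lambda>n. root n (real (fib (2 * n - 1)))) \<longlonglongrightarrow> \<psi>\<^sup>2"
      unfolding \<psi>_def by (rule root_fib_tendsto)
    show "\<forall>\<^sub>F n in sequentially.
        root n (real (fib (2 * n - 1))) = root n (real (card (avoiders R n)))"
      using eventually_ge_at_top[of 2] by eventually_elim (simp add: card_avoiders[OF that])
  qed
  show "(\<lambda>n. root n (real (card (avoiding_transversals (St3 n) [3, 2, 1])))) \<longlonglongrightarrow> \<psi>\<^sup>2"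
    unfolding card_avoiding_321 by (rule lim) simp
  show "(\<lambda>n. root n (real (card (avoiding_transversals (St3 n) [3, 1, 2])))) \<longlonglongrightarrow> \<psi>\<^sup>2"
    unfolding card_avoiding_312 by (rule lim) simp
  show "\<psi>\<^sup>2 = (3 + sqrt 5) / 2"
    by (simp add: \<psi>_def power2_eq_square field_simps)
qed

end
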